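(* Let $G$ be a simple graph with $m(G)$ edges and arranged degree sequence $d_1\ge d_2\ge\cdots\ge d_n$. Then $$\nu(G)\ge\min\Big\{k\ge 0,\ 2k\le n\ :\ \sum_{i=1}^k 2d_i+\sum_{i=k+1}^{2k}d_i\ge 2m(G)\Big\}.$$
   Context: $\nu(G)$ denotes the matching number of $G$, i.e., the maximum number of pairwise disjoint edges in $G$. *)

theory Defs
  imports Main "HOL-Library.Multiset" "HOL-Library.Disjoint_Sets"
begin

definition simple_graph :: "'a set \<Rightarrow> 'a set set \<Rightarrow> bool" where
  "simple_graph V E \<longleftrightarrow> finite V \<and> (\<forall>e\<in>E. e \<subseteq> V \<and> card e = 2)"

definition degree :: "'a set set \<Rightarrow> 'a \<Rightarrow> nat" where
  "degree E v = card {e \<in> E. v \<in> e}"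

definition matching :: "'a set set \<Rightarrow> 'a set set \<Rightarrow> bool" where
  "matching E M \<longleftrightarrow> M \<subseteq> E \<and> disjoint M"

definition matching_number :: "'a set set \<Rightarrow> nat" where
  "matching_number E = Max {card M | M. matching E M}"

text \<open>The values of \<open>d\<close> outside \<open>{1..card V}\<close> are irrelevant.\<close>

definition arranged_degree_sequence :: "'a set \<Rightarrow> 'a set set \<Rightarrow> (nat \<Rightarrow> nat) \<Rightarrow> bool" where
  "arranged_degree_sequence V E d \<longleftrightarrow>
     image_mset d (mset_set {1..card V}) = image_mset (degree E) (mset_set V) \<and>
     antimono_on {1..card V} d"

end

theory Submission
  imports Defs "HOL-Combinatorics.Permutations"
begin

text \<open>
  Let \<open>M\<close> be a maximum matching with \<open>k\<close> edges and \<open>U\<close> its set of covered vertices. Every edge meets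
  \<open>U\<close>, so \<open>2 m(G)\<close> is at most the degree sum over \<open>U\<close> plus the number of edges leaving \<open>U\<close>. Since
  no augmenting path of length three exists, the edges leaving \<open>U\<close> from the two ends of a matching
  edge pairwise intersect, and hence are no more numerous than the degree of one of these ends.
  So \<open>2 m(G)\<close> is at most a degree sum over \<open>2k\<close> vertices plus a degree sum over \<open>k\<close> vertices, and
  \<open>k\<close> itself lies in the set whose minimum is taken.
\<close>

section \<open>Degree sums against the arranged sequence\<close>

lemma sum_le_sum_initial_segment:
  fixes d :: "nat \<Rightarrow> nat"
  assumes "antimono_on {1..n} d" "T \<subseteq> {1..n}"
  shows "sum d T \<le> sum d {1..card T}"
  using assms(2)
proof (induction "card T" arbitrary: T)
  case 0
  then have "T = {}" using finite_subset[OF \<open>T \<subseteq> {1..n}\<close>] by simp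
  then show ?case by simp
next
  case (Suc c)
  have fin: "finite T" using Suc.prems finite_subset by blast
  have ne: "T \<noteq> {}" using Suc.hyps(2) by auto
  \<comment> \<open>Removing the largest index works because it is at least
    \<open>card T = Suc c\<close>; by monotonicity its term is at most \<open>d (Suc c)\<close>, the
    last term of the initial segment.\<close>
  define x where "x = Max T"
  have xT: "x \<in> T" using fin ne by (simp add: x_def)
  have "T \<subseteq> {1..x}" using Suc.prems fin by (auto simp: x_def)
  then have "card T \<le> x" using card_mono[of "{1..x}" T] by simp
  moreover have "x \<le> n" using xT Suc.prems by auto
  ultimately have dx: "d x \<le> d (Suc c)"
    using assms(1) Suc.hyps(2) by (auto simp: monotone_on_def)
  have card: "card (T - {x}) = c" using Suc.hyps(2) fin xT by simp
  have "sum d (T - {x}) \<le> sum d {1..c}"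
    using Suc.hyps(1)[of "T - {x}"] card Suc.prems by auto
  moreover have "sum d T = d x + sum d (T - {x})" using fin xT by (simp add: sum.remove)
  ultimately show ?case using dx Suc.hyps(2)[symmetric] by simp
qed

text \<open>Equality of the two multisets yields a bijection from \<open>V\<close> to the indices
  that carries degrees to values of \<open>d\<close>. A degree sum over \<open>S\<close> thus
  becomes a sum of \<open>d\<close> over \<open>card S\<close> indices.\<close>

lemma sum_degree_le_arranged:
  assumes "finite V" "arranged_degree_sequence V E d" "S \<subseteq> V"
  shows "sum (degree E) S \<le> sum d {1..card S}"
proof -
  obtain g where g: "bij_betw g {1..card V} V"
    using ex_bij_betw_nat_finite_1[OF assms(1)] by blast
  have "image_mset (degree E) (mset_set V) =
      image_mset (\<lambda>i. degree E (g i)) (mset_set {1..card V})"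
    using g image_mset_mset_set[of g "{1..card V}"]
    by (simp add: bij_betw_def flip: multiset.map_comp comp_def[of "degree E" g])
  then obtain p where p: "p permutes {1..card V}"
      "\<forall>i\<in>{1..card V}. degree E (g i) = d (p i)"
    using image_mset_eq_implies_permutes[of "{1..card V}" "\<lambda>i. degree E (g i)" d] assms(2)
    by (auto simp: arranged_degree_sequence_def)
  \<comment> \<open>\<open>h\<close> sends a vertex to a position in the arranged sequence: first
    its number under \<open>g\<close>, then the permutation matching the two listings of
    degrees.\<close>
  define h where "h = p \<circ> inv_into {1..card V} g"
  have h: "bij_betw h V {1..card V}"
    unfolding h_def
    by (rule bij_betw_trans[OF bij_betw_inv_into[OF g] permutes_imp_bij[OF p(1)]])
  have dh: "degree E v = d (h v)" if "v \<in> V" for v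
    using p(2) that bij_betw_inv_into_right[OF g that]
      bij_betwE[OF bij_betw_inv_into[OF g]] by (metis comp_apply h_def)
  have inj: "inj_on h S" using h assms(3) by (meson bij_betw_def inj_on_subset)
  have "sum (degree E) S = sum (\<lambda>v. d (h v)) S"
    using dh assms(3) by (intro sum.cong) auto
  also have "\<dots> = sum d (h ` S)" using inj by (simp add: sum.reindex)
  also have "\<dots> \<le> sum d {1..card (h ` S)}"
    using assms(2,3) h
    by (intro sum_le_sum_initial_segment[of "card V"])
      (auto simp: arranged_degree_sequence_def bij_betw_def)
  also have "card (h ` S) = card S" using inj by (rule card_image)
  finally show ?thesis .
qed

section \<open>Structure of a maximum matching\<close>

locale maximum_matching =
  fixes E M :: "'a set set"
  assumes fin: "finite E"
    and card2: "e \<in> E \<Longrightarrow> card e = 2"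
    and matching: "matching E M"
    and maximum: "matching E N \<Longrightarrow> card N \<le> card M"
begin

lemma M_subset: "M \<subseteq> E" and disj: "disjoint M"
  using matching by (auto simp: matching_def)

lemma finite_M: "finite M"
  using M_subset fin finite_subset by blast

lemma finite_edge: "e \<in> E \<Longrightarrow> finite e"
  using card2 by (metis card.infinite zero_neq_numeral)

text \<open>Otherwise the edge could be added to \<open>M\<close>. Being nonempty, it is new to
  \<open>M\<close>, so the matching would really grow.\<close>

lemma edge_meets_cover:
  assumes "e \<in> E"
  shows "e \<inter> \<Union>M \<noteq> {}"
proof
  assume e: "e \<inter> \<Union>M = {}"
  have "e \<noteq> {}" using card2[OF assms] by auto
  then have "e \<notin> M" using e by auto
  moreover have "disjoint (insert e M)"
    using disj e by (auto simp: disjoint_def)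
  then have "matching E (insert e M)"
    using assms M_subset by (simp add: matching_def)
  ultimately show False using maximum[of "insert e M"] finite_M by simp
qed

text \<open>For \<open>f\<close> in \<open>M\<close> these are the edges with one end in
  \<open>f\<close> and the other uncovered: the possible outer edges of an augmenting path of length
  three through \<open>f\<close>.\<close>

definition leaving :: "'a set \<Rightarrow> 'a set set" where
  "leaving f = {e \<in> E. \<not> e \<subseteq> \<Union>M \<and> e \<inter> f \<noteq> {}}"

lemma leaving_edge:
  assumes "f \<in> M" "e \<in> leaving f"
  obtains x w where "e = {x, w}" "x \<in> f" "w \<notin> \<Union>M"
proof -
  obtain x w where "x \<in> e" "x \<in> f" "w \<in> e" "w \<notin> \<Union>M"
    using assms by (auto simp: leaving_def)
  moreover have "card e = 2" using assms card2 by (auto simp: leaving_def)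
  ultimately have "e = {x, w}" using assms(1) by (auto simp: card_2_iff)
  then show thesis using that \<open>x \<in> f\<close> \<open>w \<notin> \<Union>M\<close> by blast
qed

text \<open>Replacing \<open>f\<close> by two disjoint edges leaving it would give a larger
  matching.\<close>

lemma leaving_intersecting:
  assumes f: "f \<in> M" and e: "e \<in> leaving f" "e' \<in> leaving f"
  shows "e \<inter> e' \<noteq> {}"
proof
  assume int: "e \<inter> e' = {}"
  \<comment> \<open>An edge leaving \<open>f\<close> meets the cover only in \<open>f\<close>, so
    the rest of \<open>M\<close> is untouched by the exchange.\<close>
  have out: "g \<inter> h = {}" if g: "g \<in> leaving f" and h: "h \<in> M - {f}" for g h
  proof -
    obtain x w where "g = {x, w}" "x \<in> f" "w \<notin> \<Union>M" using leaving_edge[OF f g] .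
    moreover have "f \<inter> h = {}" using disj f h by (auto simp: disjoint_def)
    ultimately show ?thesis using h by auto
  qed
  have nin: "g \<notin> M" "g \<in> E" "g \<noteq> {}" if "g \<in> leaving f" for g
    using that by (auto simp: leaving_def)
  define N where "N = insert e (insert e' (M - {f}))"
  have "disjoint (M - {f})" using disj by (rule pairwise_subset) auto
  moreover have "disjnt g h" "disjnt h g" if "g \<in> {e, e'}" "h \<in> M - {f}" for g h
    using that e out[of g h] by (auto simp: disjnt_def Int_commute)
  moreover have "disjnt e e'" "disjnt e' e" using int by (auto simp: disjnt_def)
  ultimately have "disjoint N" unfolding N_def pairwise_insert by auto
  then have "matching E N"
    using nin e M_subset by (auto simp: N_def matching_def)
  moreover have "e \<noteq> e'" using int nin(3)[OF e(1)] by auto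
  then have "card N = Suc (Suc (card (M - {f})))"
    using nin(1) e finite_M by (simp add: N_def)
  then have "card N = Suc (card M)"
    using card_Suc_Diff1[OF finite_M f] by simp
  ultimately show False using maximum[of N] by simp
qed

text \<open>If the edges leaving \<open>f\<close> share an end of \<open>f\<close>, the degree of
  that end bounds their number. Otherwise, as they pairwise intersect, they all run to one uncovered
  vertex, and there are at most two of them.\<close>

lemma card_leaving_le_degree:
  assumes f: "f \<in> M"
  shows "\<exists>u\<in>f. card (leaving f) \<le> degree E u"
proof -
  obtain u v where uv: "f = {u, v}" "u \<noteq> v"
    using card2 f M_subset by (meson card_2_iff subsetD)
  have sub: "leaving f \<subseteq> E" by (auto simp: leaving_def)
  have star: "card (leaving f) \<le> degree E x" if "\<forall>e\<in>leaving f. x \<in> e" for x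
    unfolding degree_def using that sub fin by (intro card_mono) auto
  show ?thesis
  proof (cases "(\<forall>e\<in>leaving f. u \<in> e) \<or> (\<forall>e\<in>leaving f. v \<in> e)")
    case True
    then show ?thesis using star uv by auto
  next
    case False
    then obtain e1 e2 where e1: "e1 \<in> leaving f" "u \<notin> e1"
      and e2: "e2 \<in> leaving f" "v \<notin> e2" by blast
    obtain w where w: "e1 = {v, w}" "w \<notin> \<Union>M"
      using leaving_edge[OF f e1(1)] e1(2) uv by (metis insertE insertI1 singletonD)
    obtain w' where w': "e2 = {u, w'}" "w' \<notin> \<Union>M"
      using leaving_edge[OF f e2(1)] e2(2) uv by (metis insertE insertI1 singletonD)
    have uvU: "u \<in> \<Union>M" "v \<in> \<Union>M" using f uv by auto
    have ww: "w' = w"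
      using leaving_intersecting[OF f e1(1) e2(1)] w w' uvU uv by auto
    have "leaving f \<subseteq> {{u, w}, {v, w}}"
    proof
      fix e assume e: "e \<in> leaving f"
      obtain x y where xy: "e = {x, y}" "x \<in> f" "y \<notin> \<Union>M" using leaving_edge[OF f e] .
      \<comment> \<open>An edge leaving \<open>f\<close> at \<open>u\<close> can meet
        \<open>e1\<close> only in \<open>w\<close>, and one leaving at \<open>v\<close> can meet
        \<open>e2\<close> only in \<open>w\<close>.\<close>
      have "y = w"
        using leaving_intersecting[OF f e e1(1)] leaving_intersecting[OF f e e2(1)]
          w w' ww uvU uv xy by auto
      then show "e \<in> {{u, w}, {v, w}}" using xy uv by auto
    qed
    then have "card (leaving f) \<le> card {{u, w}, {v, w}}" by (intro card_mono) auto
    also have "\<dots> \<le> 2" by (simp add: card_insert_if)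
    \<comment> \<open>The matching edge \<open>f\<close> itself supplies a second edge at
      \<open>u\<close> besides \<open>e2\<close>.\<close>
    also have "2 = card {f, e2}"
    proof -
      have "f \<noteq> e2" using f w' by auto
      then show ?thesis by simp
    qed
    also have "card {f, e2} \<le> degree E u"
    proof -
      have "{f, e2} \<subseteq> {e \<in> E. u \<in> e}" using f M_subset e2(1) sub uv(1) w'(1) by auto
      then show ?thesis unfolding degree_def using fin by (intro card_mono) auto
    qed
    finally have "card (leaving f) \<le> degree E u" .
    then show ?thesis using uv by auto
  qed
qed

lemma card_cover: "card (\<Union>M) = 2 * card M"
proof -
  have "card (\<Union>M) = sum card M"
    using disj M_subset finite_edge by (intro card_Union_disjoint)
      (auto simp: disjoint_def disjnt_def pairwise_def)
  also have "\<dots> = sum (\<lambda>_. 2) M" using card2 M_subset by (intro sum.cong) auto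
  finally show ?thesis by simp
qed

lemma finite_cover: "finite (\<Union>M)"
  using finite_M M_subset finite_edge by auto

text \<open>The degree sum over the cover counts an edge inside it twice and any other edge once.
  The missing units number \<open>card L\<close>, and each edge of \<open>L\<close> leaves some
  matching edge, so \<open>A\<close> collects one end of each matching edge whose degree bounds the
  edges leaving it.\<close>

lemma twice_card_le_degree_sums:
  "\<exists>A \<subseteq> \<Union>M. card A = card M \<and>
    2 * card E \<le> sum (degree E) (\<Union>M) + sum (degree E) A"
proof -
  define L where "L = {e \<in> E. \<not> e \<subseteq> \<Union>M}"
  obtain a where a: "\<And>f. f \<in> M \<Longrightarrow> a f \<in> f \<and> card (leaving f) \<le> degree E (a f)"
    using card_leaving_le_degree by metis
  \<comment> \<open>Disjointness of the matching edges makes the chosen ends distinct.\<close>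
  have inj: "inj_on a M"
    using a disj unfolding inj_on_def disjoint_def by (metis IntI empty_iff)
  have "L \<subseteq> (\<Union>f\<in>M. leaving f)"
    using edge_meets_cover by (fastforce simp: L_def leaving_def)
  then have "card L \<le> card (\<Union>f\<in>M. leaving f)"
    using fin finite_M by (intro card_mono) (auto simp: leaving_def)
  also have "\<dots> \<le> (\<Sum>f\<in>M. card (leaving f))" using finite_M by (rule card_UN_le)
  also have "\<dots> \<le> (\<Sum>f\<in>M. degree E (a f))" using a by (intro sum_mono) auto
  also have "\<dots> = sum (degree E) (a ` M)" using inj by (simp add: sum.reindex)
  finally have L: "card L \<le> sum (degree E) (a ` M)" .
  have "2 * card E = (\<Sum>e\<in>E. 2)" by simp
  also have "\<dots> \<le> (\<Sum>e\<in>E. card (e \<inter> \<Union>M) + (if e \<in> L then 1 else 0))"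
  proof (rule sum_mono)
    fix e assume e: "e \<in> E"
    have "card (e \<inter> \<Union>M) > 0"
      using edge_meets_cover[OF e] finite_edge[OF e] by (simp add: card_gt_0_iff)
    moreover have "e \<inter> \<Union>M = e" if "e \<notin> L" using that e by (auto simp: L_def)
    ultimately show "2 \<le> card (e \<inter> \<Union>M) + (if e \<in> L then 1 else 0)"
      using card2[OF e] by auto
  qed
  also have "\<dots> = (\<Sum>e\<in>E. card (e \<inter> \<Union>M)) + card L"
  proof -
    have "E \<inter> L = L" by (auto simp: L_def)
    then show ?thesis using fin by (simp add: sum.distrib flip: sum.inter_restrict)
  qed
  \<comment> \<open>Double counting of incidences between edges and covered vertices.\<close>
  also have "(\<Sum>e\<in>E. card (e \<inter> \<Union>M)) = (\<Sum>v\<in>\<Union>M. degree E v)"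
    unfolding degree_def using sum_multicount_gen[OF fin finite_cover, of "\<lambda>e v. v \<in> e" "degree E"]
    by (simp add: degree_def Int_def conj_commute)
  finally have "2 * card E \<le> sum (degree E) (\<Union>M) + sum (degree E) (a ` M)"
    using L by linarith
  moreover have "a ` M \<subseteq> \<Union>M" using a by auto
  moreover have "card (a ` M) = card M" using inj by (rule card_image)
  ultimately show ?thesis by blast
qed

end

section \<open>The bound on the matching number\<close>

lemma matching_number_attained:
  assumes "finite E"
  obtains M where "matching E M" "card M = matching_number E"
    "\<And>N. matching E N \<Longrightarrow> card N \<le> card M"
proof -
  let ?S = "{card M | M. matching E M}"
  have "?S \<subseteq> card ` Pow E" by (auto simp: matching_def)
  then have fin: "finite ?S" using assms finite_subset by blast
  \<comment> \<open>The empty matching makes the set of sizes nonempty, so that its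
    \<open>Max\<close> is attained.\<close>
  have "matching E {}" by (simp add: matching_def)
  then have "?S \<noteq> {}" by blast
  then have "Max ?S \<in> ?S" using fin by (rule Max_in[rotated])
  then obtain M where M: "matching E M" "card M = Max ?S" by auto
  then have "card N \<le> card M" if "matching E N" for N
    using that fin by (auto intro: Max_ge)
  then show thesis using that M unfolding matching_number_def by metis
qed

theorem theorem5p4:
  fixes V :: "'a set" and E :: "'a set set" and d :: "nat \<Rightarrow> nat" and n :: nat
  assumes "simple_graph V E"
    and "n = card V"
    and "arranged_degree_sequence V E d"
  shows "matching_number E \<ge>
    Min {k :: nat. 2 * k \<le> n \<and>
      (\<Sum>i = 1..k. 2 * d i) + (\<Sum>i = k + 1..2 * k. d i) \<ge> 2 * card E}"
proof -
  have V: "finite V" and E: "E \<subseteq> Pow V" "\<And>e. e \<in> E \<Longrightarrow> card e = 2"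
    using assms(1) by (auto simp: simple_graph_def)
  have finE: "finite E" using V E(1) finite_subset by blast
  obtain M where M: "matching E M" "card M = matching_number E"
    "\<And>N. matching E N \<Longrightarrow> card N \<le> card M" using matching_number_attained[OF finE] by blast
  interpret maximum_matching E M
    using finE E(2) M by unfold_locales auto
  define k where "k = card M"
  have UV: "\<Union>M \<subseteq> V" using M_subset E(1) by auto
  obtain A where A: "A \<subseteq> \<Union>M" "card A = k"
    "2 * card E \<le> sum (degree E) (\<Union>M) + sum (degree E) A"
    using twice_card_le_degree_sums k_def by blast
  have "sum (degree E) (\<Union>M) \<le> sum d {1..2 * k}"
    using sum_degree_le_arranged[OF V assms(3) UV] card_cover k_def by simp
  \<comment> \<open>Splitting at \<open>k\<close> lets the bound for the \<open>k\<close> vertices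
    of \<open>A\<close>, again the first \<open>k\<close> terms, double exactly the first
    half.\<close>
  also have "{1..2 * k} = {1..k} \<union> {k + 1..2 * k}" by auto
  also have "sum d \<dots> = sum d {1..k} + sum d {k + 1..2 * k}"
    by (intro sum.union_disjoint) auto
  finally have "sum (degree E) (\<Union>M) \<le> sum d {1..k} + sum d {k + 1..2 * k}" .
  moreover have "sum (degree E) A \<le> sum d {1..k}"
    using sum_degree_le_arranged[OF V assms(3), of A] A UV by auto
  ultimately have "2 * card E \<le> (\<Sum>i = 1..k. 2 * d i) + (\<Sum>i = k + 1..2 * k. d i)"
    using A(3) by (simp flip: sum_distrib_left)
  moreover have "2 * k \<le> n"
    using card_mono[OF V UV] card_cover assms(2) k_def by simp
  \<comment> \<open>Finiteness makes \<open>Min\<close> a lower bound for the members of the set,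
    among them the size \<open>k\<close> of the maximum matching.\<close>
  moreover have "finite {k :: nat. 2 * k \<le> n \<and>
      (\<Sum>i = 1..k. 2 * d i) + (\<Sum>i = k + 1..2 * k. d i) \<ge> 2 * card E}"
    by (rule finite_subset[of _ "{..n}"]) auto
  ultimately show ?thesis using M(2) k_def by (auto intro: Min_le)
qed

end
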